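(* Let $M=\sum_{k=1}^\infty\sigma_kB^{H_k}$ be a multi-mixed fractional Brownian motion with parameters $\sigma_k,H_k$, $k\in\mathbb{N}$, and $H_{\sup}=\sup_kH_k$. Let $\delta>0$, $\Delta_\delta M_t=M_{t+\delta}-M_t$, and let $\varrho(\delta;t)=\mathbb{E}\left[\Delta_\delta M_{s+t}\,\Delta_\delta M_s\right]$ be the autocovariance function of the stationary process $\Delta_\delta M$. Then, as $t\to\infty$, $$\varrho(\delta;t)\sim\delta^2\sum_{k=1}^\infty\sigma_k^2H_k(2H_k-1)t^{2H_k-2}=O\left(t^{2H_{\sup}-2}\right).$$ Consequently, the increment process $(\Delta_\delta M_t)_t$ is long-range dependent if and only if $H_k>\frac12$ for some $k\ge1$.
   Context: A fractional Brownian motion (fBm) with Hurst index $H\in(0,1)$ is a centered Gaussian process with continuous paths and covariance $\mathbb{E}[B^H_tB^H_s]=\frac12\left(|t|^{2H}+|s|^{2H}-|t-s|^{2H}\right)$. Multi-mixed fractional Brownian motion (mmfBm): let $\sigma_k>0$, $k\in\mathbb{N}$, satisfy $\sum_{k=1}^\infty\sigma_k^2<\infty$, and let $H_k\in(0,1)$, $k\in\mathbb{N}$, be pairwise distinct with $\inf_kH_k>0$ and $\sup_kH_k<1$. With independent fBm's $B^{H_k}$, put $M_t=\sum_{k=1}^\infty\sigma_kB^{H_k}_t$, the series converging in $L^2(\Omega)$ for each $t$. $a(t)\sim b(t)$ means $a(t)/b(t)\to1$ as $t\to\infty$. A stationary process with autocovariance function $\varrho(t)$ is long-range dependent if $\int_{t_0}^\infty|\varrho(t)|\,\mathrm{d}t=\infty$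 for some (equivalently all) $t_0>0$, and short-range dependent otherwise. *)

theory Defs
  imports "HOL-Probability.Probability" "HOL-Library.Landau_Symbols"
begin

text \<open>A stochastic process with time set \<open>T\<close> on the probability space \<open>P\<close> is a function
  \<open>X :: real \<Rightarrow> 'a \<Rightarrow> real\<close> of which only the values \<open>X t\<close> with \<open>t \<in> T\<close> matter.\<close>

text \<open>Point masses count as (degenerate) normal laws; this is needed for \<open>B\<^sub>0 = 0\<close>.\<close>

definition gaussian_variable :: "'a measure \<Rightarrow> ('a \<Rightarrow> real) \<Rightarrow> bool" where
  "gaussian_variable P Y \<longleftrightarrow>
     (\<exists>\<mu> s. 0 < s \<and> distributed P lborel Y (\<lambda>x. ennreal (normal_density \<mu> s x)))
     \<or> (\<exists>\<mu>. Y \<in> borel_measurable P \<and> (AE \<omega> in P. Y \<omega> = \<mu>))"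

definition gaussian_process :: "'a measure \<Rightarrow> real set \<Rightarrow> (real \<Rightarrow> 'a \<Rightarrow> real) \<Rightarrow> bool" where
  "gaussian_process P T X \<longleftrightarrow>
     (\<forall>t\<in>T. X t \<in> borel_measurable P) \<and>
     (\<forall>J c. finite J \<and> J \<subseteq> T \<longrightarrow> gaussian_variable P (\<lambda>\<omega>. \<Sum>t\<in>J. c t * X t \<omega>))"

definition covariance :: "'a measure \<Rightarrow> ('a \<Rightarrow> real) \<Rightarrow> ('a \<Rightarrow> real) \<Rightarrow> real" where
  "covariance P Y Z =
     (\<integral>\<omega>. (Y \<omega> - (\<integral>\<omega>'. Y \<omega>' \<partial>P)) * (Z \<omega> - (\<integral>\<omega>'. Z \<omega>' \<partial>P)) \<partial>P)"

definition fractional_brownian_motion ::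
    "'a measure \<Rightarrow> real set \<Rightarrow> real \<Rightarrow> (real \<Rightarrow> 'a \<Rightarrow> real) \<Rightarrow> bool" where
  "fractional_brownian_motion P T H B \<longleftrightarrow>
     0 < H \<and> H < 1 \<and>
     gaussian_process P T B \<and>
     (\<forall>t\<in>T. (\<integral>\<omega>. B t \<omega> \<partial>P) = 0) \<and>
     (\<forall>\<omega>\<in>space P. continuous_on T (\<lambda>t. B t \<omega>)) \<and>
     (\<forall>t\<in>T. \<forall>s\<in>T. (\<integral>\<omega>. B t \<omega> * B s \<omega> \<partial>P) =
        (\<bar>t\<bar> powr (2 * H) + \<bar>s\<bar> powr (2 * H) - \<bar>t - s\<bar> powr (2 * H)) / 2)"

text \<open>The index \<open>k\<close> runs over \<open>nat\<close> from \<open>0\<close>. Independence is that of whole processes, i.e. of random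
  elements of the product space over \<open>T\<close>. The last clause is convergence of the series in
  \<open>L\<^sup>2\<close>; it is stated with the nonnegative integral, which does not take the value \<open>0\<close> on
  functions that fail to be integrable.\<close>

definition multi_mixed_fbm ::
    "'a measure \<Rightarrow> real set \<Rightarrow> (nat \<Rightarrow> real) \<Rightarrow> (nat \<Rightarrow> real) \<Rightarrow>
     (nat \<Rightarrow> real \<Rightarrow> 'a \<Rightarrow> real) \<Rightarrow> (real \<Rightarrow> 'a \<Rightarrow> real) \<Rightarrow> bool" where
  "multi_mixed_fbm P T \<sigma> H B M \<longleftrightarrow>
     (\<forall>k. 0 < \<sigma> k) \<and> summable (\<lambda>k. (\<sigma> k)\<^sup>2) \<and>
     (\<forall>k. 0 < H k \<and> H k < 1) \<and> inj H \<and> 0 < (INF k. H k) \<and> (SUP k. H k) < 1 \<and>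
     (\<forall>k. fractional_brownian_motion P T (H k) (B k)) \<and>
     prob_space.indep_vars P (\<lambda>_. \<Pi>\<^sub>M t\<in>T. borel) (\<lambda>k \<omega>. \<lambda>t\<in>T. B k t \<omega>) UNIV \<and>
     (\<forall>t\<in>T. M t \<in> borel_measurable P \<and>
        (\<lambda>n. \<integral>\<^sup>+\<omega>. ennreal ((M t \<omega> - (\<Sum>k<n. \<sigma> k * B k t \<omega>))\<^sup>2) \<partial>P) \<longlonglongrightarrow> 0)"

definition increment :: "real \<Rightarrow> (real \<Rightarrow> 'a \<Rightarrow> real) \<Rightarrow> real \<Rightarrow> 'a \<Rightarrow> real" where
  "increment \<delta> X t = (\<lambda>\<omega>. X (t + \<delta>) \<omega> - X t \<omega>)"

text \<open>Stationarity in the wide sense, which is what an autocovariance function requires.\<close>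

definition stationary_process :: "'a measure \<Rightarrow> real set \<Rightarrow> (real \<Rightarrow> 'a \<Rightarrow> real) \<Rightarrow> bool" where
  "stationary_process P T X \<longleftrightarrow>
     (\<forall>t\<in>T. X t \<in> borel_measurable P \<and> integrable P (\<lambda>\<omega>. (X t \<omega>)\<^sup>2)) \<and>
     (\<forall>s\<in>T. \<forall>t\<in>T. (\<integral>\<omega>. X s \<omega> \<partial>P) = (\<integral>\<omega>. X t \<omega> \<partial>P)) \<and>
     (\<forall>s\<in>T. \<forall>t\<in>T. \<forall>h. s + h \<in> T \<and> t + h \<in> T \<longrightarrow>
        covariance P (X (s + h)) (X (t + h)) = covariance P (X s) (X t))"

text \<open>For a stationary process and \<open>0 \<in> T\<close>, this is the covariance of \<open>X (s + t)\<close> and \<open>X s\<close> for all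
  \<open>s, t, s + t \<in> T\<close>.\<close>

definition autocovariance :: "'a measure \<Rightarrow> (real \<Rightarrow> 'a \<Rightarrow> real) \<Rightarrow> real \<Rightarrow> real" where
  "autocovariance P X t = covariance P (X t) (X 0)"

definition long_range_dependent :: "'a measure \<Rightarrow> real set \<Rightarrow> (real \<Rightarrow> 'a \<Rightarrow> real) \<Rightarrow> bool" where
  "long_range_dependent P T X \<longleftrightarrow>
     stationary_process P T X \<and>
     (\<exists>t0>0. (\<integral>\<^sup>+t\<in>{t0..}. ennreal \<bar>autocovariance P X t\<bar> \<partial>lborel) = \<infinity>)"

end

theory Submission
  imports Defs
begin

text \<open>Uncorrelatedness of the components and convergence in \<open>L\<^sup>2\<close> turn the autocovariance of the
  increments into the series of \<open>\<sigma>\<^sub>k\<^sup>2 / 2\<close> times the second central difference of \<open>t powr (2 * H\<^sub>k)\<close>.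
  By Taylor's theorem the relative error of replacing that difference by the second derivative is
  at most \<open>(t / (t - \<delta>))\<^sup>2 - (t / (t + \<delta>))\<^sup>2\<close>, uniformly in \<open>H\<^sub>k\<close>. It therefore suffices that the
  terms of the limiting series do not cancel asymptotically.\<close>

text \<open>A term of the limiting series has the sign of \<open>H k - 1/2\<close>, so signs may be
  mixed, and the supremum of the \<open>H k\<close> need not be attained, so no leading power can be
  factored out. Relative errors of the single terms control only the sum of the moduli,
  \<open>abs_modes\<close>; hence the central estimate is that this sum is eventually at most twice
  the modulus of the signed sum. Distinctness of the \<open>H k\<close> enters here: at most one of
  them equals \<open>1/2\<close>, so the series does not vanish identically. The power bound does
  not settle the dependence question: if all \<open>H k\<close> are at most \<open>1/2\<close> with
  supremum \<open>1/2\<close>, it reads O(1/t), which leaves integrability open. Finiteness comes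
  from integrating the moduli term by term, divergence from one term with index above
  \<open>1/2\<close>, which dominates a multiple of \<open>1/t\<close>. Probability enters only
  through the series for the covariance; the two locales contain real analysis alone.\<close>

section \<open>Square integrable functions and limits in L2\<close>

definition square_integrable :: "'a measure \<Rightarrow> ('a \<Rightarrow> real) \<Rightarrow> bool" where
  "square_integrable M f \<longleftrightarrow> f \<in> borel_measurable M \<and> integrable M (\<lambda>x. (f x)\<^sup>2)"

lemma square_integrableD [measurable_dest]: "square_integrable M f \<Longrightarrow> f \<in> borel_measurable M"
  by (simp add: square_integrable_def)

lemma square_integrable_mult:
  assumes "square_integrable M f" "square_integrable M g"
  shows "integrable M (\<lambda>x. f x * g x)"
proof (rule Bochner_Integration.integrable_bound[where f="\<lambda>x. (f x)\<^sup>2 + (g x)\<^sup>2"])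
  show "AE x in M. norm (f x * g x) \<le> norm ((f x)\<^sup>2 + (g x)\<^sup>2)"
  proof (rule AE_I2)
    fix x
    have "2 * \<bar>f x\<bar> * \<bar>g x\<bar> \<le> (f x)\<^sup>2 + (g x)\<^sup>2"
      using sum_squares_bound[of "\<bar>f x\<bar>" "\<bar>g x\<bar>"] by simp
    moreover have "0 \<le> \<bar>f x\<bar> * \<bar>g x\<bar>" by simp
    ultimately have "\<bar>f x\<bar> * \<bar>g x\<bar> \<le> (f x)\<^sup>2 + (g x)\<^sup>2" by linarith
    then show "norm (f x * g x) \<le> norm ((f x)\<^sup>2 + (g x)\<^sup>2)" by (simp add: abs_mult)
  qed
qed (use assms in \<open>auto simp: square_integrable_def\<close>)

lemma square_integrable_add:
  assumes "square_integrable M f" "square_integrable M g"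
  shows "square_integrable M (\<lambda>x. f x + g x)"
  using assms square_integrable_mult[OF assms]
  by (auto simp: square_integrable_def power2_sum mult.assoc)

lemma square_integrable_cmult:
  assumes "square_integrable M f"
  shows "square_integrable M (\<lambda>x. c * f x)"
  using assms by (auto simp: square_integrable_def power_mult_distrib)

lemma square_integrable_diff:
  assumes "square_integrable M f" "square_integrable M g"
  shows "square_integrable M (\<lambda>x. f x - g x)"
  using square_integrable_add[OF assms(1) square_integrable_cmult[OF assms(2), of "-1"]] by simp

lemma square_integrable_sum:
  assumes "\<And>i. i \<in> I \<Longrightarrow> square_integrable M (f i)"
  shows "square_integrable M (\<lambda>x. \<Sum>i\<in>I. f i x)"
proof (cases "finite I")
  case True
  then show ?thesis using assms
    by (induction I) (auto intro!: square_integrable_add simp: square_integrable_def[of M "\<lambda>x. 0"])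
qed (simp add: square_integrable_def)

lemma (in prob_space) square_integrable_const: "square_integrable M (\<lambda>x. c)"
  by (simp add: square_integrable_def)

lemma (in prob_space) square_integrable_integrable:
  "square_integrable M f \<Longrightarrow> integrable M f"
  by (simp add: square_integrable_def square_integrable_imp_integrable)

text \<open>The inequality for nonnegative integrals carries over to Bochner integrals because
  square integrability makes all three integrals finite.\<close>

lemma Cauchy_Schwarz_integral:
  assumes "square_integrable M f" "square_integrable M g"
  shows "\<bar>\<integral>x. f x * g x \<partial>M\<bar> \<le> sqrt (\<integral>x. (f x)\<^sup>2 \<partial>M) * sqrt (\<integral>x. (g x)\<^sup>2 \<partial>M)"
proof -
  note [measurable] = assms[THEN square_integrableD]
  have fg: "integrable M (\<lambda>x. \<bar>f x * g x\<bar>)"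
    using square_integrable_mult[OF assms] by simp
  have f2: "integrable M (\<lambda>x. (f x)\<^sup>2)" and g2: "integrable M (\<lambda>x. (g x)\<^sup>2)"
    using assms by (auto simp: square_integrable_def)
  have "(\<integral>\<^sup>+x. ennreal \<bar>f x\<bar> * ennreal \<bar>g x\<bar> \<partial>M)\<^sup>2
      \<le> (\<integral>\<^sup>+x. (ennreal \<bar>f x\<bar>)\<^sup>2 \<partial>M) * (\<integral>\<^sup>+x. (ennreal \<bar>g x\<bar>)\<^sup>2 \<partial>M)"
    by (rule Cauchy_Schwarz_nn_integral) measurable
  then have "ennreal ((\<integral>x. \<bar>f x * g x\<bar> \<partial>M)\<^sup>2) \<le> ennreal ((\<integral>x. (f x)\<^sup>2 \<partial>M) * (\<integral>x. (g x)\<^sup>2 \<partial>M))"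
    by (simp add: ennreal_mult[symmetric] abs_mult[symmetric] ennreal_power
        nn_integral_eq_integral[OF fg] nn_integral_eq_integral[OF f2] nn_integral_eq_integral[OF g2])
  then have "(\<integral>x. \<bar>f x * g x\<bar> \<partial>M)\<^sup>2 \<le> (\<integral>x. (f x)\<^sup>2 \<partial>M) * (\<integral>x. (g x)\<^sup>2 \<partial>M)"
    by (simp add: ennreal_le_iff)
  then have "(\<integral>x. \<bar>f x * g x\<bar> \<partial>M) \<le> sqrt ((\<integral>x. (f x)\<^sup>2 \<partial>M) * (\<integral>x. (g x)\<^sup>2 \<partial>M))"
    by (rule real_le_rsqrt)
  with integral_abs_bound[of M "\<lambda>x. f x * g x"] show ?thesis
    unfolding real_sqrt_mult by (rule order_trans)
qed

text \<open>One approximant at finite distance puts the limit in L2, since X = (X - Xn) + Xn. Only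
  then do Bochner integrals of the squared differences carry the same information as the nonnegative
  integrals in the definition of the process.\<close>

lemma L2_limit_square_integrable:
  fixes X :: "'a \<Rightarrow> real"
  assumes "X \<in> borel_measurable M" "\<And>n. square_integrable M (Xn n)"
    and lim: "(\<lambda>n. \<integral>\<^sup>+x. ennreal ((X x - Xn n x)\<^sup>2) \<partial>M) \<longlonglongrightarrow> 0"
  shows "square_integrable M X"
    and "(\<lambda>n. \<integral>x. (X x - Xn n x)\<^sup>2 \<partial>M) \<longlonglongrightarrow> 0"
proof -
  note [measurable] = assms(1) square_integrableD[OF assms(2)]
  have "eventually (\<lambda>n. (\<integral>\<^sup>+x. ennreal ((X x - Xn n x)\<^sup>2) \<partial>M) < 1) sequentially"
    using lim by (rule order_tendstoD) simp
  then obtain n where "(\<integral>\<^sup>+x. ennreal ((X x - Xn n x)\<^sup>2) \<partial>M) < 1"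
    by (auto simp: eventually_sequentially)
  then have "(\<integral>\<^sup>+x. ennreal ((X x - Xn n x)\<^sup>2) \<partial>M) < \<infinity>"
    using less_trans by fastforce
  then have "square_integrable M (\<lambda>x. X x - Xn n x)"
    unfolding square_integrable_def by (auto intro!: integrableI_bounded)
  from square_integrable_add[OF this assms(2)[of n]]
  show X: "square_integrable M X" by simp
  have "ennreal (\<integral>x. (X x - Xn n x)\<^sup>2 \<partial>M) = (\<integral>\<^sup>+x. ennreal ((X x - Xn n x)\<^sup>2) \<partial>M)" for n
    using square_integrable_diff[OF X assms(2)[of n]]
    by (intro nn_integral_eq_integral[symmetric]) (auto simp: square_integrable_def)
  then have "(\<lambda>n. ennreal (\<integral>x. (X x - Xn n x)\<^sup>2 \<partial>M)) \<longlonglongrightarrow> ennreal 0"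
    using lim by simp
  then show "(\<lambda>n. \<integral>x. (X x - Xn n x)\<^sup>2 \<partial>M) \<longlonglongrightarrow> 0"
    by (rule tendsto_ennrealD) simp_all
qed

text \<open>With U = X - Xn and V = Y - Yn, the product Xn * Yn equals XY - UY - XV + UV. Each of
  the last three terms contains a factor tending to 0 in L2, and the other factor is fixed or tends
  to 0 as well, so Cauchy-Schwarz applies without a uniform bound on the approximants.\<close>

lemma L2_limit_inner:
  assumes X: "square_integrable M X" and Y: "square_integrable M Y"
    and Xn: "\<And>n. square_integrable M (Xn n)" and Yn: "\<And>n. square_integrable M (Yn n)"
    and limX: "(\<lambda>n. \<integral>x. (X x - Xn n x)\<^sup>2 \<partial>M) \<longlonglongrightarrow> 0"
    and limY: "(\<lambda>n. \<integral>x. (Y x - Yn n x)\<^sup>2 \<partial>M) \<longlonglongrightarrow> 0"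
  shows "(\<lambda>n. \<integral>x. Xn n x * Yn n x \<partial>M) \<longlonglongrightarrow> (\<integral>x. X x * Y x \<partial>M)"
proof -
  define U where "U n = (\<lambda>x. X x - Xn n x)" for n
  define V where "V n = (\<lambda>x. Y x - Yn n x)" for n
  have U: "square_integrable M (U n)" and V: "square_integrable M (V n)" for n
    unfolding U_def V_def by (intro square_integrable_diff X Y Xn Yn)+
  have limU: "(\<lambda>n. \<integral>x. (U n x)\<^sup>2 \<partial>M) \<longlonglongrightarrow> 0" and limV: "(\<lambda>n. \<integral>x. (V n x)\<^sup>2 \<partial>M) \<longlonglongrightarrow> 0"
    using limX limY by (simp_all add: U_def V_def)
  have UY: "(\<lambda>n. \<integral>x. U n x * Y x \<partial>M) \<longlonglongrightarrow> 0"
  proof (rule Lim_null_comparison)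
    show "\<forall>\<^sub>F n in sequentially. norm (\<integral>x. U n x * Y x \<partial>M)
        \<le> sqrt (\<integral>x. (U n x)\<^sup>2 \<partial>M) * sqrt (\<integral>x. (Y x)\<^sup>2 \<partial>M)"
      using Cauchy_Schwarz_integral[OF U Y] by simp
    show "(\<lambda>n. sqrt (\<integral>x. (U n x)\<^sup>2 \<partial>M) * sqrt (\<integral>x. (Y x)\<^sup>2 \<partial>M)) \<longlonglongrightarrow> 0"
      using tendsto_mult[OF tendsto_real_sqrt[OF limU] tendsto_const] by simp
  qed
  have XV: "(\<lambda>n. \<integral>x. X x * V n x \<partial>M) \<longlonglongrightarrow> 0"
  proof (rule Lim_null_comparison)
    show "\<forall>\<^sub>F n in sequentially. norm (\<integral>x. X x * V n x \<partial>M)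
        \<le> sqrt (\<integral>x. (X x)\<^sup>2 \<partial>M) * sqrt (\<integral>x. (V n x)\<^sup>2 \<partial>M)"
      using Cauchy_Schwarz_integral[OF X V] by simp
    show "(\<lambda>n. sqrt (\<integral>x. (X x)\<^sup>2 \<partial>M) * sqrt (\<integral>x. (V n x)\<^sup>2 \<partial>M)) \<longlonglongrightarrow> 0"
      using tendsto_mult[OF tendsto_const tendsto_real_sqrt[OF limV]] by simp
  qed
  have UV: "(\<lambda>n. \<integral>x. U n x * V n x \<partial>M) \<longlonglongrightarrow> 0"
  proof (rule Lim_null_comparison)
    show "\<forall>\<^sub>F n in sequentially. norm (\<integral>x. U n x * V n x \<partial>M)
        \<le> sqrt (\<integral>x. (U n x)\<^sup>2 \<partial>M) * sqrt (\<integral>x. (V n x)\<^sup>2 \<partial>M)"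
      using Cauchy_Schwarz_integral[OF U V] by simp
    show "(\<lambda>n. sqrt (\<integral>x. (U n x)\<^sup>2 \<partial>M) * sqrt (\<integral>x. (V n x)\<^sup>2 \<partial>M)) \<longlonglongrightarrow> 0"
      using tendsto_mult[OF tendsto_real_sqrt[OF limU] tendsto_real_sqrt[OF limV]] by simp
  qed
  have "(\<integral>x. Xn n x * Yn n x \<partial>M) = (\<integral>x. X x * Y x \<partial>M) - (\<integral>x. U n x * Y x \<partial>M)
      - (\<integral>x. X x * V n x \<partial>M) + (\<integral>x. U n x * V n x \<partial>M)" for n
  proof -
    have "(\<integral>x. Xn n x * Yn n x \<partial>M) = (\<integral>x. X x * Y x - U n x * Y x - X x * V n x + U n x * V n x \<partial>M)"
      by (intro Bochner_Integration.integral_cong) (simp_all add: U_def V_def algebra_simps)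
    then show ?thesis by (simp add: square_integrable_mult X Y U V)
  qed
  then show ?thesis using tendsto_add[OF tendsto_diff[OF tendsto_diff[OF tendsto_const UY] XV] UV]
    by simp
qed

section \<open>First and second moments of the mixed process\<close>

lemma (in prob_space) gaussian_variable_square_integrable:
  assumes "gaussian_variable M Y"
  shows "square_integrable M Y"
proof -
  from assms consider \<mu> s where "0 < s" "distributed M lborel Y (\<lambda>x. ennreal (normal_density \<mu> s x))"
    | \<mu> where "Y \<in> borel_measurable M" "AE \<omega> in M. Y \<omega> = \<mu>"
    unfolding gaussian_variable_def by blast
  then show ?thesis
  proof cases
    case 1
    have [measurable]: "Y \<in> borel_measurable M"
      using distributed_measurable[OF 1(2)] by simp
    \<comment> \<open>The moments of a normal density are integrable in centred form; the constant
      \<open>\<mu>\<close> is added back afterwards.\<close>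
    have "integrable M (\<lambda>x. (Y x - \<mu>)\<^sup>2)"
      using distributed_integrable[OF 1(2), of "\<lambda>x. (x - \<mu>)\<^sup>2"] integrable_normal_moment[OF 1(1), of \<mu> 2]
      by simp
    then have "square_integrable M (\<lambda>x. Y x - \<mu>)"
      by (simp add: square_integrable_def)
    from square_integrable_add[OF this square_integrable_const[of \<mu>]] show ?thesis by simp
  next
    case 2
    have "integrable M (\<lambda>x. (Y x)\<^sup>2) \<longleftrightarrow> integrable M (\<lambda>x. \<mu>\<^sup>2)"
      using 2 by (intro integrable_cong_AE) auto
    then show ?thesis using 2 by (simp add: square_integrable_def)
  qed
qed

lemma (in prob_space) fbm_square_integrable:
  assumes "fractional_brownian_motion M T H B" "t \<in> T"
  shows "square_integrable M (B t)"
proof -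
  have "gaussian_variable M (\<lambda>\<omega>. \<Sum>u\<in>{t}. 1 * B u \<omega>)"
    using assms(1) unfolding fractional_brownian_motion_def gaussian_process_def
    by (elim conjE allE[of _ "{t}"] allE[of _ "\<lambda>_. 1"] impE) (use assms(2) in simp_all)
  from gaussian_variable_square_integrable[OF this] show ?thesis by simp
qed

text \<open>Evaluation at a fixed time is measurable on the product space, so evaluating each
  process at its own time preserves independence. As \<open>i\<close> and \<open>j\<close> differ,
  the choice of times \<open>u\<close> can give \<open>t\<close> to \<open>i\<close> and
  \<open>s\<close> to all other indices.\<close>

lemma (in prob_space) indep_processes_uncorrelated:
  fixes B :: "'i \<Rightarrow> 't \<Rightarrow> 'a \<Rightarrow> real"
  assumes indep: "indep_vars (\<lambda>_. \<Pi>\<^sub>M t\<in>T. borel) (\<lambda>k \<omega>. \<lambda>t\<in>T. B k t \<omega>) UNIV"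
    and "i \<noteq> j" "t \<in> T" "s \<in> T" "integrable M (B i t)" "integrable M (B j s)"
  shows "expectation (\<lambda>\<omega>. B i t \<omega> * B j s \<omega>) = expectation (B i t) * expectation (B j s)"
proof -
  define u where "u k = (if k = i then t else s)" for k
  have u: "u k \<in> T" for k using assms by (simp add: u_def)
  have "indep_vars (\<lambda>_. borel) (\<lambda>k \<omega>. (\<lambda>t\<in>T. B k t \<omega>) (u k)) UNIV"
    by (rule indep_vars_compose2[OF indep, where Y="\<lambda>k x. x (u k)"])
      (rule measurable_component_singleton[OF u])
  then have "indep_vars (\<lambda>_. borel) (\<lambda>k. B k (u k)) UNIV"
    using u by simp
  then have "indep_vars (\<lambda>_. borel) (\<lambda>k. B k (u k)) {i, j}"
    by (rule indep_vars_subset[OF _ subset_UNIV])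
  then have "expectation (\<lambda>\<omega>. \<Prod>k\<in>{i, j}. B k (u k) \<omega>) = (\<Prod>k\<in>{i, j}. expectation (B k (u k)))"
    by (rule indep_vars_lebesgue_integral[rotated]) (use assms(2,5,6) in \<open>auto simp: u_def\<close>)
  then show ?thesis using assms(2) by (simp add: u_def)
qed

lemma (in prob_space) multi_mixed_fbm_moments:
  assumes mm: "multi_mixed_fbm M T \<sigma> H B X" and t: "t \<in> T"
  shows "square_integrable M (X t)"
    and "expectation (X t) = 0"
    and "s \<in> T \<Longrightarrow> (\<lambda>k. (\<sigma> k)\<^sup>2 * ((\<bar>t\<bar> powr (2 * H k) + \<bar>s\<bar> powr (2 * H k) - \<bar>t - s\<bar> powr (2 * H k)) / 2))
           sums expectation (\<lambda>\<omega>. X t \<omega> * X s \<omega>)"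
proof -
  define S where "S u n = (\<lambda>\<omega>. \<Sum>k<n. \<sigma> k * B k u \<omega>)" for u and n :: nat
  have fbm: "fractional_brownian_motion M T (H k) (B k)" for k
    using mm by (simp add: multi_mixed_fbm_def)
  have B: "square_integrable M (B k u)" "integrable M (B k u)" "expectation (B k u) = 0" if "u \<in> T" for k u
  proof -
    show *: "square_integrable M (B k u)" by (rule fbm_square_integrable[OF fbm that])
    show "integrable M (B k u)" by (rule square_integrable_integrable[OF *])
    show "expectation (B k u) = 0"
      using fbm[of k] that unfolding fractional_brownian_motion_def by blast
  qed
  have S: "square_integrable M (S u n)" if "u \<in> T" for u n
    unfolding S_def using that by (intro square_integrable_sum square_integrable_cmult B)
  have lim: "(\<lambda>n. \<integral>\<^sup>+\<omega>. ennreal ((X u \<omega> - S u n \<omega>)\<^sup>2) \<partial>M) \<longlonglongrightarrow> 0" "X u \<in> borel_measurable M"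
    if "u \<in> T" for u
    using mm that unfolding multi_mixed_fbm_def S_def by blast+
  have X: "square_integrable M (X u)" "(\<lambda>n. \<integral>\<omega>. (X u \<omega> - S u n \<omega>)\<^sup>2 \<partial>M) \<longlonglongrightarrow> 0" if "u \<in> T" for u
    using L2_limit_square_integrable[OF lim(2)[OF that] S[OF that] lim(1)[OF that]] .
  show "square_integrable M (X t)" using X t by simp
  \<comment> \<open>The mean is treated as the inner product with the constant 1, so the limit
    theorem for inner products also yields the first moment.\<close>
  have "(\<lambda>n. \<integral>\<omega>. S t n \<omega> * 1 \<partial>M) \<longlonglongrightarrow> (\<integral>\<omega>. X t \<omega> * 1 \<partial>M)"
    by (rule L2_limit_inner) (auto intro!: X S t square_integrable_const)
  moreover have "(\<integral>\<omega>. S t n \<omega> * 1 \<partial>M) = 0" for n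
    using B[OF t] by (simp add: S_def Bochner_Integration.integral_sum)
  ultimately show "expectation (X t) = 0"
    by (simp add: LIMSEQ_const_iff)
  assume s: "s \<in> T"
  have "(\<lambda>n. \<integral>\<omega>. S t n \<omega> * S s n \<omega> \<partial>M) \<longlonglongrightarrow> expectation (\<lambda>\<omega>. X t \<omega> * X s \<omega>)"
    by (rule L2_limit_inner) (auto intro!: X S t s)
  moreover have "(\<integral>\<omega>. S t n \<omega> * S s n \<omega> \<partial>M) = (\<Sum>k<n. (\<sigma> k)\<^sup>2 *
      ((\<bar>t\<bar> powr (2 * H k) + \<bar>s\<bar> powr (2 * H k) - \<bar>t - s\<bar> powr (2 * H k)) / 2))" for n
  proof -
    have cov: "expectation (\<lambda>\<omega>. B i t \<omega> * B j s \<omega>) = (if i = j then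
        (\<bar>t\<bar> powr (2 * H i) + \<bar>s\<bar> powr (2 * H i) - \<bar>t - s\<bar> powr (2 * H i)) / 2 else 0)" for i j
    proof (cases "i = j")
      case True
      then show ?thesis using fbm[of i] t s unfolding fractional_brownian_motion_def by simp
    next
      case False
      have "indep_vars (\<lambda>_. \<Pi>\<^sub>M t\<in>T. borel) (\<lambda>k \<omega>. \<lambda>t\<in>T. B k t \<omega>) UNIV"
        using mm by (simp add: multi_mixed_fbm_def)
      from indep_processes_uncorrelated[OF this False t s B(2)[OF t] B(2)[OF s]] show ?thesis
        using B(3)[OF t] False by simp
    qed
    have "(\<integral>\<omega>. S t n \<omega> * S s n \<omega> \<partial>M)
        = (\<integral>\<omega>. (\<Sum>i<n. \<Sum>j<n. (\<sigma> i * \<sigma> j) * (B i t \<omega> * B j s \<omega>)) \<partial>M)"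
      by (intro Bochner_Integration.integral_cong) (simp_all add: S_def sum_product mult.assoc mult.left_commute[of "B _ _ _" "\<sigma> _"])
    also have "\<dots> = (\<Sum>i<n. \<Sum>j<n. (\<sigma> i * \<sigma> j) * expectation (\<lambda>\<omega>. B i t \<omega> * B j s \<omega>))"
      using square_integrable_mult[OF B(1)[OF t] B(1)[OF s]]
      by (simp add: Bochner_Integration.integral_sum)
    also have "\<dots> = (\<Sum>k<n. (\<sigma> k)\<^sup>2 *
      ((\<bar>t\<bar> powr (2 * H k) + \<bar>s\<bar> powr (2 * H k) - \<bar>t - s\<bar> powr (2 * H k)) / 2))"
      by (intro sum.cong) (simp_all add: cov if_distrib[where f="\<lambda>x. _ * x"] power2_eq_square cong: if_cong)
    finally show ?thesis .
  qed
  ultimately show "(\<lambda>k. (\<sigma> k)\<^sup>2 * ((\<bar>t\<bar> powr (2 * H k) + \<bar>s\<bar> powr (2 * H k) - \<bar>t - s\<bar> powr (2 * H k)) / 2))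
           sums expectation (\<lambda>\<omega>. X t \<omega> * X s \<omega>)"
    by (simp add: sums_def)
qed

section \<open>Autocovariance of the increments as a series\<close>

text \<open>This is the autocovariance at lag \<open>t\<close> of the increments over a step
  \<delta> of a fractional Brownian motion with index \<open>h\<close> (fractional Gaussian noise).
  The absolute values make it valid also for negative lags and for lags shorter than
  \<delta>.\<close>

definition increment_cov :: "real \<Rightarrow> real \<Rightarrow> real \<Rightarrow> real" where
  "increment_cov \<delta> h t = (\<bar>t + \<delta>\<bar> powr (2 * h) + \<bar>t - \<delta>\<bar> powr (2 * h) - 2 * \<bar>t\<bar> powr (2 * h)) / 2"

text \<open>Expanding the product gives four covariances of the process. In their signed sum the
  powers of the single times cancel and only those of time differences survive; this dependence on
  \<open>t - s\<close> alone is what later gives stationarity.\<close>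

lemma (in prob_space) multi_mixed_fbm_increment:
  assumes mm: "multi_mixed_fbm M T \<sigma> H B X" and t: "t \<in> T" "t + \<delta> \<in> T"
  shows "square_integrable M (increment \<delta> X t)"
    and "expectation (increment \<delta> X t) = 0"
    and "\<lbrakk>s \<in> T; s + \<delta> \<in> T\<rbrakk> \<Longrightarrow> (\<lambda>k. (\<sigma> k)\<^sup>2 * increment_cov \<delta> (H k) (t - s))
           sums expectation (\<lambda>\<omega>. increment \<delta> X t \<omega> * increment \<delta> X s \<omega>)"
    and "\<lbrakk>s \<in> T; s + \<delta> \<in> T\<rbrakk> \<Longrightarrow> covariance M (increment \<delta> X t) (increment \<delta> X s)
           = expectation (\<lambda>\<omega>. increment \<delta> X t \<omega> * increment \<delta> X s \<omega>)"
proof -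
  note X = multi_mixed_fbm_moments[OF mm]
  show "square_integrable M (increment \<delta> X t)"
    unfolding increment_def using X(1) t by (intro square_integrable_diff)
  have zero: "expectation (increment \<delta> X u) = 0" if "u \<in> T" "u + \<delta> \<in> T" for u
    using that X(2) square_integrable_integrable[OF X(1)] by (simp add: increment_def)
  then show "expectation (increment \<delta> X t) = 0" using t by simp
  assume s: "s \<in> T" "s + \<delta> \<in> T"
  show "covariance M (increment \<delta> X t) (increment \<delta> X s)
           = expectation (\<lambda>\<omega>. increment \<delta> X t \<omega> * increment \<delta> X s \<omega>)"
    using zero t s by (simp add: covariance_def)
  have "expectation (\<lambda>\<omega>. increment \<delta> X t \<omega> * increment \<delta> X s \<omega>)
     = expectation (\<lambda>\<omega>. X (t + \<delta>) \<omega> * X (s + \<delta>) \<omega> - X (t + \<delta>) \<omega> * X s \<omega> - X t \<omega> * X (s + \<delta>) \<omega> + X t \<omega> * X s \<omega>)"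
    by (intro Bochner_Integration.integral_cong) (simp_all add: increment_def algebra_simps)
  also have "\<dots> = expectation (\<lambda>\<omega>. X (t + \<delta>) \<omega> * X (s + \<delta>) \<omega>) - expectation (\<lambda>\<omega>. X (t + \<delta>) \<omega> * X s \<omega>)
      - expectation (\<lambda>\<omega>. X t \<omega> * X (s + \<delta>) \<omega>) + expectation (\<lambda>\<omega>. X t \<omega> * X s \<omega>)"
    using t s by (simp add: square_integrable_mult X(1))
  finally have eq: "expectation (\<lambda>\<omega>. increment \<delta> X t \<omega> * increment \<delta> X s \<omega>) = \<dots>" .
  have eq2: "t - (s + \<delta>) = t - s - \<delta>" "t + \<delta> - s = t - s + \<delta>" "t + \<delta> - (s + \<delta>) = t - s" by simp_all
  show "(\<lambda>k. (\<sigma> k)\<^sup>2 * increment_cov \<delta> (H k) (t - s))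
           sums expectation (\<lambda>\<omega>. increment \<delta> X t \<omega> * increment \<delta> X s \<omega>)"
    unfolding eq
  proof (rule sums_cong[THEN iffD1, rotated])
    show "(\<lambda>k. (\<sigma> k)\<^sup>2 * ((\<bar>t + \<delta>\<bar> powr (2 * H k) + \<bar>s + \<delta>\<bar> powr (2 * H k) - \<bar>t - s\<bar> powr (2 * H k)) / 2)
       - (\<sigma> k)\<^sup>2 * ((\<bar>t + \<delta>\<bar> powr (2 * H k) + \<bar>s\<bar> powr (2 * H k) - \<bar>t - s + \<delta>\<bar> powr (2 * H k)) / 2)
       - (\<sigma> k)\<^sup>2 * ((\<bar>t\<bar> powr (2 * H k) + \<bar>s + \<delta>\<bar> powr (2 * H k) - \<bar>t - s - \<delta>\<bar> powr (2 * H k)) / 2)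
       + (\<sigma> k)\<^sup>2 * ((\<bar>t\<bar> powr (2 * H k) + \<bar>s\<bar> powr (2 * H k) - \<bar>t - s\<bar> powr (2 * H k)) / 2))
      sums (expectation (\<lambda>\<omega>. X (t + \<delta>) \<omega> * X (s + \<delta>) \<omega>) - expectation (\<lambda>\<omega>. X (t + \<delta>) \<omega> * X s \<omega>)
        - expectation (\<lambda>\<omega>. X t \<omega> * X (s + \<delta>) \<omega>) + expectation (\<lambda>\<omega>. X t \<omega> * X s \<omega>))"
      using X(3)[OF t(2) s(2)] X(3)[OF t(2) s(1)] X(3)[OF t(1) s(2)] X(3)[OF t(1) s(1)]
      unfolding eq2 by (intro sums_add sums_diff)
  qed (simp add: increment_cov_def right_diff_distrib distrib_left diff_divide_distrib add_divide_distrib)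
qed

section \<open>Comparison of the second difference with the second derivative, uniformly in the
  index\<close>

text \<open>Moving \<xi> to an endpoint is monotone for a fixed exponent. At the endpoints the ratio
  is below or above 1, so raising the exponent to 2 lowers the lower bound and raises the upper one;
  this removes \<open>p\<close> from the bounds.\<close>

lemma powr_ratio_bounds:
  fixes t \<delta> \<xi> p :: real
  assumes "0 < \<delta>" "\<delta> < t" "t - \<delta> \<le> \<xi>" "\<xi> \<le> t + \<delta>" "0 \<le> p" "p \<le> 2"
  shows "(t / (t + \<delta>))\<^sup>2 \<le> (t / \<xi>) powr p" and "(t / \<xi>) powr p \<le> (t / (t - \<delta>))\<^sup>2"
proof -
  have pos: "0 < t - \<delta>" "0 < \<xi>" "0 < t" "0 < t + \<delta>" using assms by auto
  have "(t / (t + \<delta>))\<^sup>2 = (t / (t + \<delta>)) powr 2" using pos by (simp add: powr_numeral)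
  also have "\<dots> \<le> (t / (t + \<delta>)) powr p" using pos assms by (intro powr_mono') auto
  also have "\<dots> \<le> (t / \<xi>) powr p" using pos assms by (intro powr_mono2 divide_left_mono) auto
  finally show "(t / (t + \<delta>))\<^sup>2 \<le> (t / \<xi>) powr p" .
  have "(t / \<xi>) powr p \<le> (t / (t - \<delta>)) powr p" using pos assms by (intro powr_mono2 divide_left_mono) auto
  also have "\<dots> \<le> (t / (t - \<delta>)) powr 2" using pos assms by (intro powr_mono) auto
  also have "\<dots> = (t / (t - \<delta>))\<^sup>2" using pos by (simp add: powr_numeral)
  finally show "(t / \<xi>) powr p \<le> (t / (t - \<delta>))\<^sup>2" .
qed

lemma increment_cov_approx:
  fixes t \<delta> h :: real
  assumes \<delta>: "0 < \<delta>" "\<delta> < t" and h: "0 < h" "h < 1"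
  shows "\<bar>increment_cov \<delta> h t - \<delta>\<^sup>2 * (h * (2 * h - 1) * t powr (2 * h - 2))\<bar>
    \<le> ((t / (t - \<delta>))\<^sup>2 - (t / (t + \<delta>))\<^sup>2) * (\<delta>\<^sup>2 * \<bar>h * (2 * h - 1) * t powr (2 * h - 2)\<bar>)"
proof -
  define a where "a = 2 * h"
  \<comment> \<open>The power and its first two derivatives; Taylor's formula of order 2 consults
    only \<open>m\<close> up to 2, so the last branch stands for the second derivative.\<close>
  define D :: "nat \<Rightarrow> real \<Rightarrow> real" where
    "D m x = (if m = 0 then x powr a else if m = 1 then a * x powr (a - 1)
      else a * (a - 1) * x powr (a - 2))" for m x
  have D: "DERIV (D m) x :> D (Suc m) x" if "m < 2" "0 < x" for m x
  proof -
    consider "m = 0" | "m = 1" using \<open>m < 2\<close> by linarith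
    then show ?thesis
    proof cases
      case 1
      then show ?thesis using has_real_derivative_powr[OF \<open>0 < x\<close>, of a] by (simp add: D_def[abs_def])
    next
      case 2
      then show ?thesis
        using DERIV_cmult[OF has_real_derivative_powr[OF \<open>0 < x\<close>, of "a - 1"], of a]
        by (simp add: D_def[abs_def] mult.assoc)
    qed
  qed
  have "\<exists>\<xi>. t < \<xi> \<and> \<xi> < t + \<delta> \<and> (t + \<delta>) powr a
      = (\<Sum>m<2. (D m t / fact m) * (t + \<delta> - t) ^ m) + (D 2 \<xi> / fact 2) * (t + \<delta> - t)\<^sup>2"
    by (rule Taylor_up[where a = t and diff = D]) (use \<delta> D in \<open>auto simp: D_def\<close>)
  then obtain \<xi>1 where \<xi>1: "t < \<xi>1" "\<xi>1 < t + \<delta>"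
      and up: "(t + \<delta>) powr a = t powr a + a * t powr (a - 1) * \<delta> + a * (a - 1) * \<xi>1 powr (a - 2) / 2 * \<delta>\<^sup>2"
    by (auto simp: D_def numeral_2_eq_2)
  have "\<exists>\<xi>. t - \<delta> < \<xi> \<and> \<xi> < t \<and> (t - \<delta>) powr a
      = (\<Sum>m<2. (D m t / fact m) * (t - \<delta> - t) ^ m) + (D 2 \<xi> / fact 2) * (t - \<delta> - t)\<^sup>2"
    by (rule Taylor_down[where b = t and diff = D]) (use \<delta> D in \<open>auto simp: D_def\<close>)
  then obtain \<xi>2 where \<xi>2: "t - \<delta> < \<xi>2" "\<xi>2 < t"
      and down: "(t - \<delta>) powr a = t powr a - a * t powr (a - 1) * \<delta> + a * (a - 1) * \<xi>2 powr (a - 2) / 2 * \<delta>\<^sup>2"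
    by (auto simp: D_def numeral_2_eq_2)
  \<comment> \<open>Extracts the reference power at \<open>t\<close> from the remainder; the
    exponent \<open>2 - a\<close> of the remaining ratio lies between 0 and 2.\<close>
  have ratio: "\<xi> powr (a - 2) = (t / \<xi>) powr (2 - a) * t powr (a - 2)" if "0 < \<xi>" for \<xi>
    using that \<delta> by (simp add: powr_divide powr_diff)
  define r1 where "r1 = (t / \<xi>1) powr (2 - a)"
  define r2 where "r2 = (t / \<xi>2) powr (2 - a)"
  define L where "L = (t / (t + \<delta>))\<^sup>2"
  define U where "U = (t / (t - \<delta>))\<^sup>2"
  have r: "L \<le> r1" "r1 \<le> U" "L \<le> r2" "r2 \<le> U"
    unfolding r1_def r2_def L_def U_def using \<xi>1 \<xi>2 \<delta> h by (intro powr_ratio_bounds; simp add: a_def)+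
  have "L \<le> 1" "1 \<le> U" unfolding L_def U_def using \<delta> by (auto intro!: power_le_one one_le_power)
  \<comment> \<open>The mean of \<open>r1\<close> and \<open>r2\<close> and the number 1 both lie in
    the interval from \<open>L\<close> to \<open>U\<close>, so they differ by at most its
    length.\<close>
  with r have bound: "\<bar>(r1 + r2) / 2 - 1\<bar> \<le> U - L" by (simp add: abs_le_iff field_simps)
  define c where "c = \<delta>\<^sup>2 * (h * (2 * h - 1) * t powr (2 * h - 2))"
  have "increment_cov \<delta> h t = ((t + \<delta>) powr a + (t - \<delta>) powr a - 2 * t powr a) / 2"
    using \<delta> by (simp add: increment_cov_def a_def)
  also have "\<dots> = \<delta>\<^sup>2 * a * (a - 1) * (\<xi>1 powr (a - 2) + \<xi>2 powr (a - 2)) / 4"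
    unfolding up down by (simp add: field_simps)
  also have "\<dots> = \<delta>\<^sup>2 * a * (a - 1) * ((r1 + r2) * t powr (a - 2)) / 4"
    using ratio[of \<xi>1] ratio[of \<xi>2] \<xi>1 \<xi>2 \<delta> by (simp add: r1_def r2_def distrib_right)
  also have "\<dots> = c * ((r1 + r2) / 2)"
    by (simp add: c_def a_def)
  finally have "increment_cov \<delta> h t - c = c * ((r1 + r2) / 2 - 1)" by (simp add: algebra_simps)
  then have "\<bar>increment_cov \<delta> h t - c\<bar> = \<bar>c\<bar> * \<bar>(r1 + r2) / 2 - 1\<bar>" by (simp only: abs_mult)
  also have "\<dots> \<le> \<bar>c\<bar> * (U - L)" by (intro mult_left_mono bound) simp
  finally show ?thesis by (simp add: c_def U_def L_def abs_mult mult.commute)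
qed

lemma increment_cov_bound:
  fixes t \<delta> h R :: real
  assumes "0 \<le> t" "0 < \<delta>" "t \<le> R" "0 < h" "h < 1"
  shows "\<bar>increment_cov \<delta> h t\<bar> \<le> 2 * (1 + (R + \<delta>)\<^sup>2)"
proof -
  have b: "\<bar>x\<bar> powr (2 * h) \<le> 1 + (R + \<delta>)\<^sup>2" if "\<bar>x\<bar> \<le> R + \<delta>" for x
  proof (cases "\<bar>x\<bar> \<le> 1")
    case True
    then have "\<bar>x\<bar> powr (2 * h) \<le> 1" using assms by (simp add: powr_le1)
    then show ?thesis by (smt (verit) zero_le_power2)
  next
    case False
    then have "\<bar>x\<bar> powr (2 * h) \<le> \<bar>x\<bar> powr 2" using assms by (intro powr_mono) auto
    also have "\<dots> = \<bar>x\<bar>\<^sup>2" using False by (simp add: powr_numeral)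
    also have "\<dots> \<le> (R + \<delta>)\<^sup>2" using that by (intro power_mono) auto
    finally show ?thesis by simp
  qed
  have *: "\<bar>(x + y - 2 * z) / 2\<bar> \<le> 2 * K"
    if "0 \<le> x" "x \<le> K" "0 \<le> y" "y \<le> K" "0 \<le> z" "z \<le> K" for x y z K :: real
    using that by (simp add: abs_le_iff)
  show ?thesis
    unfolding increment_cov_def by (rule *; (rule b)?) (use assms in simp_all)
qed

section \<open>Growth of powers and integrals over half-lines\<close>

lemma eventually_powr_ge:
  fixes q K :: real
  assumes "0 < q"
  shows "\<forall>\<^sub>F t in at_top. K \<le> t powr q"
proof (rule eventually_at_top_linorderI)
  fix t assume t: "max 1 (\<bar>K\<bar> powr (1 / q)) \<le> t"
  have "K \<le> (\<bar>K\<bar> powr (1 / q)) powr q" using assms by (simp add: powr_powr)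
  also have "\<dots> \<le> t powr q" using t assms by (intro powr_mono2) auto
  finally show "K \<le> t powr q" .
qed

lemma nn_integral_inverse_atLeast:
  fixes c T0 :: real
  assumes "0 < c" "0 < T0"
  shows "(\<integral>\<^sup>+t\<in>{T0..}. ennreal (c / t) \<partial>lborel) = \<infinity>"
proof (rule ccontr)
  assume "\<not> ?thesis"
  then obtain r where r: "0 \<le> r" "(\<integral>\<^sup>+t\<in>{T0..}. ennreal (c / t) \<partial>lborel) = ennreal r"
    by (metis ennreal_cases infinity_ennreal_def)
  \<comment> \<open>Chosen so that \<open>c * ln (b / T0)\<close> is \<open>r + 1\<close>, one more
    than the supposed value of the whole integral.\<close>
  define b where "b = T0 * exp ((r + 1) / c)"
  have b: "T0 \<le> b" using assms r by (simp add: b_def)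
  have "(\<integral>\<^sup>+t. ennreal (c / t) * indicator {T0..b} t \<partial>lborel) = ennreal (c * ln b - c * ln T0)"
    using assms b by (intro nn_integral_FTC_Icc) (auto intro!: derivative_eq_intros)
  also have "c * ln b - c * ln T0 = r + 1"
    using assms by (simp add: b_def ln_mult field_simps)
  finally have "ennreal (r + 1) \<le> ennreal r"
    using nn_integral_mono[of lborel "\<lambda>t. ennreal (c / t) * indicator {T0..b} t"
        "\<lambda>t. ennreal (c / t) * indicator {T0..} t"] r(2)
    by (simp add: indicator_def)
  then show False using r(1) by (simp add: ennreal_le_iff)
qed

text \<open>The factor \<open>1 - 2 * h\<close> makes the integrand the derivative of
  \<open>- (t powr (2 * h - 1))\<close>, so for \<open>h < 1/2\<close> the integral is
  \<open>T0 powr (2 * h - 1)\<close>. At \<open>h = 1/2\<close> the primitive no longer tends to 0,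
  but the integrand vanishes.\<close>

lemma nn_integral_powr_atLeast_le:
  fixes h T0 :: real
  assumes "h \<le> 1 / 2" "1 \<le> T0"
  shows "(\<integral>\<^sup>+t\<in>{T0..}. ennreal ((1 - 2 * h) * t powr (2 * h - 2)) \<partial>lborel) \<le> 1"
proof (cases "h = 1 / 2")
  case True
  then have "1 - 2 * h = 0" by simp
  then show ?thesis by simp
next
  case False
  have "((\<lambda>t. - (t powr (2 * h - 1))) \<longlongrightarrow> - 0) at_top"
    using assms False by (intro tendsto_minus tendsto_neg_powr filterlim_ident) auto
  then have "(\<integral>\<^sup>+t\<in>{T0..}. ennreal ((1 - 2 * h) * t powr (2 * h - 2)) \<partial>lborel)
      = ennreal (- 0 - - (T0 powr (2 * h - 1)))"
    using assms
    by (intro nn_integral_FTC_atLeast)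
      (auto intro!: derivative_eq_intros mult_nonneg_nonneg simp: algebra_simps)
  also have "\<dots> \<le> ennreal 1"
    using assms powr_mono[of "2 * h - 1" 0 T0] by (intro ennreal_leI) simp
  finally show ?thesis by simp
qed

section \<open>The limiting series and its absolute counterpart\<close>

locale mmfbm_params =
  fixes \<sigma> H :: "nat \<Rightarrow> real"
  assumes \<sigma>_pos: "0 < \<sigma> k" and \<sigma>_summable: "summable (\<lambda>k. (\<sigma> k)\<^sup>2)"
    and H_pos: "0 < H k" and H_less_1: "H k < 1" and H_inj: "inj H"
begin

definition mode :: "nat \<Rightarrow> real \<Rightarrow> real" where
  "mode k t = (\<sigma> k)\<^sup>2 * H k * (2 * H k - 1) * t powr (2 * H k - 2)"

text \<open>The scale for all error estimates: an error relative to each term adds up to an error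
  relative to this sum, not to the possibly smaller signed one.\<close>

definition abs_modes :: "real \<Rightarrow> real" where
  "abs_modes t = (\<Sum>k. \<bar>mode k t\<bar>)"

lemma abs_mode_le: "\<bar>mode k t\<bar> \<le> (\<sigma> k)\<^sup>2 * t powr (2 * H k - 2)"
proof -
  have "\<bar>H k * (2 * H k - 1)\<bar> \<le> 1 * 1"
    unfolding abs_mult using H_pos[of k] H_less_1[of k] by (intro mult_mono) auto
  then have "(\<sigma> k)\<^sup>2 * t powr (2 * H k - 2) * \<bar>H k * (2 * H k - 1)\<bar> \<le> (\<sigma> k)\<^sup>2 * t powr (2 * H k - 2) * 1"
    by (intro mult_left_mono) auto
  then show ?thesis by (simp add: mode_def abs_mult mult_ac)
qed

lemma abs_mode_le_powr:
  assumes "1 \<le> t" "H k \<le> h"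
  shows "\<bar>mode k t\<bar> \<le> (\<sigma> k)\<^sup>2 * t powr (2 * h - 2)"
proof -
  have "(\<sigma> k)\<^sup>2 * t powr (2 * H k - 2) \<le> (\<sigma> k)\<^sup>2 * t powr (2 * h - 2)"
    using assms by (intro mult_left_mono powr_mono) auto
  with abs_mode_le[of k t] show ?thesis by simp
qed

lemma summable_abs_mode:
  assumes "0 < t"
  shows "summable (\<lambda>k. \<bar>mode k t\<bar>)"
proof (rule summable_comparison_test')
  show "summable (\<lambda>k. (\<sigma> k)\<^sup>2 * (1 + t powr (- 2)))"
    \<comment> \<open>The exponent \<open>2 * H k - 2\<close> lies between -2 and 0: the summand 1
      covers \<open>t \<ge> 1\<close>, the summand \<open>t powr (- 2)\<close> covers
      \<open>t < 1\<close>.\<close>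
    by (intro summable_mult2 \<sigma>_summable)
  fix k
  have "t powr (2 * H k - 2) \<le> 1 + t powr (- 2)"
  proof (cases "1 \<le> t")
    case True
    then have "t powr (2 * H k - 2) \<le> t powr 0"
      using H_less_1[of k] by (intro powr_mono) auto
    then show ?thesis using True by (simp add: add_increasing2)
  next
    case False
    then have "t powr (2 * H k - 2) \<le> t powr (- 2)"
      using H_pos[of k] assms by (intro powr_mono') auto
    then show ?thesis by simp
  qed
  then have "(\<sigma> k)\<^sup>2 * t powr (2 * H k - 2) \<le> (\<sigma> k)\<^sup>2 * (1 + t powr (- 2))"
    by (intro mult_left_mono) auto
  then show "norm \<bar>mode k t\<bar> \<le> (\<sigma> k)\<^sup>2 * (1 + t powr (- 2))"
    using abs_mode_le[of k t] by simp
qed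

lemma summable_mode: "0 < t \<Longrightarrow> summable (\<lambda>k. mode k t)"
  using summable_abs_mode by (rule summable_rabs_cancel)

lemma abs_mode_le_abs_modes: "0 < t \<Longrightarrow> \<bar>mode k t\<bar> \<le> abs_modes t"
  unfolding abs_modes_def using sum_le_suminf[OF summable_abs_mode, of t "{k}"] by simp

lemma abs_modes_pos:
  assumes "0 < t"
  shows "0 < abs_modes t"
proof -
  \<comment> \<open>By injectivity \<open>H 0\<close> and \<open>H 1\<close> cannot both be
    \<open>1/2\<close>, the only value in the admissible range for which a mode vanishes.\<close>
  obtain k where "H k \<noteq> 1 / 2"
    using H_inj injD[OF H_inj, of 0 1] by (metis zero_neq_one)
  then have "0 < \<bar>mode k t\<bar>"
    using \<sigma>_pos[of k] H_pos[of k] assms by (simp add: mode_def)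
  with abs_mode_le_abs_modes[OF assms, of k] show ?thesis by simp
qed

lemma abs_modes_le_powr:
  assumes "1 \<le> t" "\<And>k. H k \<le> h"
  shows "abs_modes t \<le> (\<Sum>k. (\<sigma> k)\<^sup>2) * t powr (2 * h - 2)"
proof -
  have "abs_modes t \<le> (\<Sum>k. (\<sigma> k)\<^sup>2 * t powr (2 * h - 2))"
    unfolding abs_modes_def using assms
    by (intro suminf_le abs_mode_le_powr summable_abs_mode summable_mult2 \<sigma>_summable) auto
  also have "\<dots> = (\<Sum>k. (\<sigma> k)\<^sup>2) * t powr (2 * h - 2)"
    by (rule suminf_mult2[symmetric, OF \<sigma>_summable])
  finally show ?thesis .
qed

lemma abs_suminf_mode_le: "0 < t \<Longrightarrow> \<bar>\<Sum>k. mode k t\<bar> \<le> abs_modes t"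
  unfolding abs_modes_def by (intro summable_rabs summable_abs_mode)

text \<open>A mode with Hurst index above \<open>1/2\<close> eventually outweighs all the negative ones, which are
  \<open>O(1/t)\<close>; without such a mode all signs agree.\<close>

lemma abs_modes_le_suminf: "\<forall>\<^sub>F t in at_top. abs_modes t \<le> 2 * \<bar>\<Sum>k. mode k t\<bar>"
proof (cases "\<exists>j. 1 / 2 < H j")
  case False
  have "abs_modes t \<le> 2 * \<bar>\<Sum>k. mode k t\<bar>" if "1 \<le> t" for t
  proof -
    have "mode k t \<le> 0" for k
    proof -
      have "H k \<le> 1 / 2" using False not_less by blast
      then show ?thesis using H_pos[of k] unfolding mode_def
        by (intro mult_nonpos_nonneg[OF mult_nonneg_nonpos]) auto
    qed
    then have "abs_modes t = (\<Sum>k. - mode k t)" by (simp add: abs_modes_def)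
    also have "\<dots> = - (\<Sum>k. mode k t)"
      using summable_mode[of t] that by (simp add: suminf_minus)
    finally show ?thesis by simp
  qed
  then show ?thesis by (rule eventually_at_top_linorderI)
next
  case True
  then obtain j where j: "1 / 2 < H j" by blast
  define V where "V = (\<Sum>k. (\<sigma> k)\<^sup>2)"
  define c where "c = (\<sigma> j)\<^sup>2 * H j * (2 * H j - 1)"
  have c: "0 < c" using j \<sigma>_pos[of j] H_pos[of j] by (simp add: c_def)
  \<comment> \<open>Beyond this threshold the total correction \<open>2 * V / t\<close> is at most
    half of the \<open>j\<close>-th mode, hence at most half of \<open>abs_modes t\<close>;
    absorbing it on the left produces the factor 2.\<close>
  have "\<forall>\<^sub>F t in at_top. 4 * V / c \<le> t powr (2 * H j - 1)"
    using j by (intro eventually_powr_ge) simp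
  then show ?thesis
    using eventually_ge_at_top[of 1]
  proof eventually_elim
    case (elim t)
    then have t: "0 < t" by simp
    \<comment> \<open>A negative term differs from its modulus by twice that modulus, hence the 2;
      for the other terms no correction is required.\<close>
    have neg: "\<bar>mode k t\<bar> \<le> mode k t + (\<sigma> k)\<^sup>2 * (2 / t)" for k
    proof (cases "H k \<le> 1 / 2")
      case True
      have "\<bar>mode k t\<bar> \<le> (\<sigma> k)\<^sup>2 * t powr (2 * (1 / 2) - 2)"
        using elim True by (intro abs_mode_le_powr) auto
      also have "\<dots> = (\<sigma> k)\<^sup>2 * (1 / t)" using t by (simp add: powr_minus_divide)
      finally have le: "\<bar>mode k t\<bar> \<le> (\<sigma> k)\<^sup>2 * (1 / t)" .
      have double: "\<bar>x\<bar> \<le> x + v" if "\<bar>x\<bar> \<le> w" "v = 2 * w" for x v w :: real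
        using that by linarith
      show ?thesis by (rule double[OF le]) simp
    next
      case False
      then have "0 \<le> mode k t" using H_pos[of k] by (simp add: mode_def)
      then show ?thesis using t by simp
    qed
    have "abs_modes t \<le> (\<Sum>k. mode k t + (\<sigma> k)\<^sup>2 * (2 / t))"
      unfolding abs_modes_def using t
      by (intro suminf_le neg summable_abs_mode summable_add summable_mode summable_mult2 \<sigma>_summable)
    also have "\<dots> = (\<Sum>k. mode k t) + (\<Sum>k. (\<sigma> k)\<^sup>2 * (2 / t))"
      using t by (intro suminf_add[symmetric] summable_mode summable_mult2 \<sigma>_summable)
    also have "(\<Sum>k. (\<sigma> k)\<^sup>2 * (2 / t)) = V * (2 / t)"
      unfolding V_def by (rule suminf_mult2[symmetric, OF \<sigma>_summable])
    finally have 1: "abs_modes t \<le> (\<Sum>k. mode k t) + V * (2 / t)" .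
    have "4 * V \<le> c * t powr (2 * H j - 1)" using elim(1) c by (simp add: field_simps)
    then have "V * (2 / t) \<le> c * t powr (2 * H j - 1) / (2 * t)" using t by (simp add: field_simps)
    also have "\<dots> = mode j t / 2"
    proof -
      have "t powr (2 * H j - 2) = t powr (2 * H j - 1) / t"
        using t powr_diff[of t "2 * H j - 1" 1] by simp
      then show ?thesis by (simp add: mode_def c_def)
    qed
    also have "\<dots> \<le> abs_modes t / 2" using abs_mode_le_abs_modes[OF t, of j] by simp
    finally show ?case using 1 by simp
  qed
qed

end

section \<open>Asymptotics and integrability of the autocovariance\<close>

locale mmfbm_increment_cov = mmfbm_params +
  fixes \<delta> :: real and \<rho> :: "real \<Rightarrow> real"
  assumes \<delta>_pos: "0 < \<delta>"
    and \<rho>_sums: "0 \<le> t \<Longrightarrow> (\<lambda>k. (\<sigma> k)\<^sup>2 * increment_cov \<delta> (H k) t) sums \<rho> t"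
begin

definition rel_err :: "real \<Rightarrow> real" where
  "rel_err t = (t / (t - \<delta>))\<^sup>2 - (t / (t + \<delta>))\<^sup>2"

lemma rel_err_tendsto: "(rel_err \<longlongrightarrow> 0) at_top"
proof -
  have d: "((\<lambda>t. \<delta> / t) \<longlongrightarrow> 0) at_top"
    by (rule tendsto_divide_0[OF tendsto_const filterlim_at_top_imp_at_infinity[OF filterlim_ident]])
  have "((\<lambda>t. (1 / (1 - \<delta> / t))\<^sup>2 - (1 / (1 + \<delta> / t))\<^sup>2) \<longlongrightarrow> (1 / (1 - 0))\<^sup>2 - (1 / (1 + 0))\<^sup>2) at_top"
    by (intro tendsto_intros d) auto
  then have "((\<lambda>t. (1 / (1 - \<delta> / t))\<^sup>2 - (1 / (1 + \<delta> / t))\<^sup>2) \<longlongrightarrow> 0) at_top" by simp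
  moreover have "\<forall>\<^sub>F t in at_top. (1 / (1 - \<delta> / t))\<^sup>2 - (1 / (1 + \<delta> / t))\<^sup>2 = rel_err t"
    using eventually_gt_at_top[of \<delta>] eventually_gt_at_top[of 0]
  proof eventually_elim
    case (elim t)
    then have "1 / (1 - \<delta> / t) = t / (t - \<delta>)" "1 / (1 + \<delta> / t) = t / (t + \<delta>)"
      using \<delta>_pos by (simp_all add: field_simps)
    then show ?case by (simp add: rel_err_def)
  qed
  ultimately show ?thesis by (rule Lim_transform_eventually)
qed

text \<open>\<open>rel_err t\<close> is the same for every index, so it leaves the sum of the term
  errors, and the moduli of the modes remain.\<close>

lemma \<rho>_approx:
  assumes t: "\<delta> < t"
  shows "\<bar>\<rho> t - \<delta>\<^sup>2 * (\<Sum>k. mode k t)\<bar> \<le> rel_err t * (\<delta>\<^sup>2 * abs_modes t)"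
proof -
  have t0: "0 < t" using t \<delta>_pos by simp
  define E where "E k = (\<sigma> k)\<^sup>2 * increment_cov \<delta> (H k) t - \<delta>\<^sup>2 * mode k t" for k
  have "E sums (\<rho> t - \<delta>\<^sup>2 * (\<Sum>k. mode k t))"
    unfolding E_def[abs_def] using t0
    by (intro sums_diff \<rho>_sums sums_mult summable_sums summable_mode) auto
  then have eq: "\<rho> t - \<delta>\<^sup>2 * (\<Sum>k. mode k t) = (\<Sum>k. E k)" by (simp add: sums_iff)
  have E: "\<bar>E k\<bar> \<le> rel_err t * (\<delta>\<^sup>2 * \<bar>mode k t\<bar>)" for k
  proof -
    have "\<bar>E k\<bar> = (\<sigma> k)\<^sup>2 * \<bar>increment_cov \<delta> (H k) t - \<delta>\<^sup>2 * (H k * (2 * H k - 1) * t powr (2 * H k - 2))\<bar>"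
    proof -
      have "E k = (\<sigma> k)\<^sup>2 * (increment_cov \<delta> (H k) t - \<delta>\<^sup>2 * (H k * (2 * H k - 1) * t powr (2 * H k - 2)))"
        by (simp add: E_def mode_def algebra_simps)
      then show ?thesis by (simp add: abs_mult)
    qed
    also have "\<dots> \<le> (\<sigma> k)\<^sup>2 * (rel_err t * (\<delta>\<^sup>2 * \<bar>H k * (2 * H k - 1) * t powr (2 * H k - 2)\<bar>))"
      unfolding rel_err_def
      by (intro mult_left_mono increment_cov_approx \<delta>_pos t H_pos H_less_1) simp
    also have "\<dots> = rel_err t * (\<delta>\<^sup>2 * \<bar>mode k t\<bar>)"
      by (simp add: mode_def abs_mult)
    finally show ?thesis .
  qed
  have sm: "summable (\<lambda>k. rel_err t * (\<delta>\<^sup>2 * \<bar>mode k t\<bar>))"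
    using t0 by (intro summable_mult summable_abs_mode)
  have smE: "summable (\<lambda>k. \<bar>E k\<bar>)"
    by (rule summable_comparison_test'[OF sm]) (use E in simp)
  have "\<bar>\<Sum>k. E k\<bar> \<le> (\<Sum>k. \<bar>E k\<bar>)" by (rule summable_rabs[OF smE])
  also have "\<dots> \<le> (\<Sum>k. rel_err t * (\<delta>\<^sup>2 * \<bar>mode k t\<bar>))" by (rule suminf_le[OF E smE sm])
  also have "\<dots> = rel_err t * (\<delta>\<^sup>2 * abs_modes t)"
    unfolding abs_modes_def using t0
    by (simp add: suminf_mult summable_abs_mode summable_mult)
  finally show ?thesis unfolding eq .
qed

lemma \<rho>_asymp: "((\<lambda>t. \<rho> t / (\<delta>\<^sup>2 * (\<Sum>k. mode k t))) \<longlongrightarrow> 1) at_top"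
proof -
  have "((\<lambda>t. \<rho> t / (\<delta>\<^sup>2 * (\<Sum>k. mode k t)) - 1) \<longlongrightarrow> 0) at_top"
  proof (rule Lim_null_comparison)
    show "((\<lambda>t. \<bar>rel_err t\<bar> * 2) \<longlongrightarrow> 0) at_top"
      using tendsto_mult[OF tendsto_rabs[OF rel_err_tendsto] tendsto_const, of 2] by simp
    show "\<forall>\<^sub>F t in at_top. norm (\<rho> t / (\<delta>\<^sup>2 * (\<Sum>k. mode k t)) - 1) \<le> \<bar>rel_err t\<bar> * 2"
      using eventually_gt_at_top[of \<delta>] abs_modes_le_suminf
    proof eventually_elim
      case (elim t)
      define S where "S = (\<Sum>k. mode k t)"
      have t0: "0 < t" using elim \<delta>_pos by simp
      \<comment> \<open>The quotient is genuine for large \<open>t\<close>: the positive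
        \<open>abs_modes t\<close> is at most twice the modulus of \<open>S\<close>.\<close>
      have S: "0 < \<bar>S\<bar>" using abs_modes_pos[OF t0] elim by (simp add: S_def)
      have "\<bar>\<rho> t - \<delta>\<^sup>2 * S\<bar> \<le> rel_err t * (\<delta>\<^sup>2 * abs_modes t)"
        unfolding S_def by (rule \<rho>_approx[OF elim(1)])
      also have "\<dots> \<le> \<bar>rel_err t\<bar> * (\<delta>\<^sup>2 * (2 * \<bar>S\<bar>))"
        using elim(2) abs_modes_pos[OF t0] by (intro mult_mono) (auto simp: S_def)
      finally have "\<bar>\<rho> t - \<delta>\<^sup>2 * S\<bar> \<le> \<bar>rel_err t\<bar> * 2 * \<bar>\<delta>\<^sup>2 * S\<bar>" by (simp add: abs_mult)
      moreover have "\<rho> t / (\<delta>\<^sup>2 * S) - 1 = (\<rho> t - \<delta>\<^sup>2 * S) / (\<delta>\<^sup>2 * S)"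
        using S \<delta>_pos by (simp add: field_simps)
      ultimately show ?case
        using S \<delta>_pos unfolding S_def[symmetric]
        by (simp add: abs_divide pos_divide_le_eq abs_mult)
    qed
  qed
  then show ?thesis by (rule LIM_zero_cancel)
qed

lemma modes_bigo:
  assumes "\<And>k. H k \<le> h"
  shows "(\<lambda>t. \<delta>\<^sup>2 * (\<Sum>k. mode k t)) \<in> O(\<lambda>t. t powr (2 * h - 2))"
proof (rule bigoI)
  show "\<forall>\<^sub>F t in at_top. norm (\<delta>\<^sup>2 * (\<Sum>k. mode k t))
      \<le> (\<delta>\<^sup>2 * (\<Sum>k. (\<sigma> k)\<^sup>2)) * norm (t powr (2 * h - 2))"
    using eventually_ge_at_top[of 1]
  proof eventually_elim
    case (elim t)
    then have "\<bar>\<Sum>k. mode k t\<bar> \<le> (\<Sum>k. (\<sigma> k)\<^sup>2) * t powr (2 * h - 2)"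
      using abs_suminf_mode_le[of t] abs_modes_le_powr[OF elim assms] by simp
    then show ?case by (simp add: abs_mult mult.assoc mult_left_mono)
  qed
qed

lemma \<rho>_bigo:
  assumes "\<And>k. H k \<le> h"
  shows "\<rho> \<in> O(\<lambda>t. t powr (2 * h - 2))"
  using asymp_equiv_imp_bigo[OF asymp_equivI'[OF \<rho>_asymp]] modes_bigo[OF assms]
  by (rule landau_o.big_trans)

lemma nn_integral_\<rho>_infinite:
  assumes "1 / 2 < H j"
  shows "\<exists>t0>0. (\<integral>\<^sup>+t\<in>{t0..}. ennreal \<bar>\<rho> t\<bar> \<partial>lborel) = \<infinity>"
proof -
  define c where "c = \<delta>\<^sup>2 * ((\<sigma> j)\<^sup>2 * H j * (2 * H j - 1)) / 4"
  have c: "0 < c" using assms \<sigma>_pos[of j] H_pos[of j] \<delta>_pos by (simp add: c_def)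
  \<comment> \<open>With \<open>G\<close> the scaled sum of moduli, the limiting series is at least
    \<open>G / 2\<close> in modulus and the error at most \<open>G / 4\<close>. This leaves
    \<open>G / 4\<close> for \<rho> and explains the 4 in \<open>c\<close>.\<close>
  have "\<forall>\<^sub>F t in at_top. rel_err t < 1 / 4"
    using rel_err_tendsto by (rule order_tendstoD) simp
  then have "\<forall>\<^sub>F t in at_top. c / t \<le> \<bar>\<rho> t\<bar>"
    using eventually_gt_at_top[of \<delta>] eventually_ge_at_top[of 1] abs_modes_le_suminf
  proof eventually_elim
    case (elim t)
    then have t0: "0 < t" by simp
    define G where "G = \<delta>\<^sup>2 * abs_modes t"
    have G: "0 < G" using abs_modes_pos[OF t0] \<delta>_pos by (simp add: G_def)
    have "\<bar>\<rho> t - \<delta>\<^sup>2 * (\<Sum>k. mode k t)\<bar> \<le> rel_err t * G"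
      unfolding G_def by (rule \<rho>_approx[OF elim(2)])
    also have "\<dots> \<le> 1 / 4 * G" using elim(1) G by (intro mult_right_mono) auto
    finally have 1: "\<bar>\<rho> t - \<delta>\<^sup>2 * (\<Sum>k. mode k t)\<bar> \<le> 1 / 4 * G" .
    have "G \<le> \<delta>\<^sup>2 * (2 * \<bar>\<Sum>k. mode k t\<bar>)"
      unfolding G_def using elim(4) by (intro mult_left_mono) auto
    then have 2: "G \<le> 2 * \<bar>\<delta>\<^sup>2 * (\<Sum>k. mode k t)\<bar>" by (simp add: abs_mult)
    have "c / t = c * t powr (- 1)" using t0 by (simp add: powr_minus_divide)
    also have "\<dots> \<le> c * t powr (2 * H j - 2)"
      using c elim(3) assms by (intro mult_left_mono powr_mono) auto
    also have "\<dots> = \<delta>\<^sup>2 * mode j t / 4" by (simp add: c_def mode_def)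
    also have "\<dots> \<le> \<delta>\<^sup>2 * \<bar>mode j t\<bar> / 4" by (simp add: mult_left_mono)
    also have "\<dots> \<le> G / 4"
      unfolding G_def using abs_mode_le_abs_modes[OF t0, of j] by (simp add: mult_left_mono)
    finally have "c / t \<le> G / 4" .
    with 1 2 show ?case by linarith
  qed
  then obtain T0 where T0: "\<And>t. T0 \<le> t \<Longrightarrow> c / t \<le> \<bar>\<rho> t\<bar>"
    by (auto simp: eventually_at_top_linorder)
  define t0 where "t0 = max 1 T0"
  have "(\<integral>\<^sup>+t\<in>{t0..}. ennreal (c / t) \<partial>lborel) \<le> (\<integral>\<^sup>+t\<in>{t0..}. ennreal \<bar>\<rho> t\<bar> \<partial>lborel)"
    using T0 by (intro nn_integral_mono) (auto simp: t0_def indicator_def intro!: ennreal_leI)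
  moreover have "(\<integral>\<^sup>+t\<in>{t0..}. ennreal (c / t) \<partial>lborel) = \<infinity>"
    using c by (intro nn_integral_inverse_atLeast) (auto simp: t0_def)
  ultimately show ?thesis
    by (intro exI[of _ t0]) (auto simp: t0_def top.extremum_unique)
qed

text \<open>Controls the initial stretch of lags, including those up to \<delta>, to which
  \<open>\<rho>_approx\<close> does not apply.\<close>

lemma abs_\<rho>_le:
  assumes "0 \<le> t" "t \<le> R"
  shows "\<bar>\<rho> t\<bar> \<le> (\<Sum>k. (\<sigma> k)\<^sup>2) * (2 * (1 + (R + \<delta>)\<^sup>2))"
proof -
  have le: "\<bar>(\<sigma> k)\<^sup>2 * increment_cov \<delta> (H k) t\<bar> \<le> (\<sigma> k)\<^sup>2 * (2 * (1 + (R + \<delta>)\<^sup>2))" for k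
    unfolding abs_mult abs_power2
    using increment_cov_bound[OF assms(1) \<delta>_pos assms(2) H_pos H_less_1] by (intro mult_left_mono) auto
  have sm: "summable (\<lambda>k. (\<sigma> k)\<^sup>2 * (2 * (1 + (R + \<delta>)\<^sup>2)))"
    by (intro summable_mult2 \<sigma>_summable)
  have sm': "summable (\<lambda>k. \<bar>(\<sigma> k)\<^sup>2 * increment_cov \<delta> (H k) t\<bar>)"
    by (rule summable_comparison_test'[OF sm]) (use le in simp)
  have "\<bar>\<rho> t\<bar> = \<bar>\<Sum>k. (\<sigma> k)\<^sup>2 * increment_cov \<delta> (H k) t\<bar>"
    using \<rho>_sums[OF assms(1)] by (simp add: sums_iff)
  also have "\<dots> \<le> (\<Sum>k. \<bar>(\<sigma> k)\<^sup>2 * increment_cov \<delta> (H k) t\<bar>)" by (rule summable_rabs[OF sm'])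
  also have "\<dots> \<le> (\<Sum>k. (\<sigma> k)\<^sup>2 * (2 * (1 + (R + \<delta>)\<^sup>2)))" by (rule suminf_le[OF le sm' sm])
  also have "\<dots> = (\<Sum>k. (\<sigma> k)\<^sup>2) * (2 * (1 + (R + \<delta>)\<^sup>2))"
    by (rule suminf_mult2[symmetric, OF \<sigma>_summable])
  finally show ?thesis .
qed

text \<open>The integral of the \<open>k\<close>-th mode over \<open>{T0..}\<close> is at most \<open>(\<sigma> k)\<^sup>2\<close>, because the factor
  \<open>1 - 2 * H k\<close> cancels the one produced by integration; so \<open>H k\<close> may accumulate at \<open>1/2\<close>.\<close>

lemma nn_integral_abs_modes_finite:
  assumes H: "\<And>k. H k \<le> 1 / 2" and T0: "1 \<le> T0"
  shows "(\<integral>\<^sup>+t\<in>{T0..}. ennreal (abs_modes t) \<partial>lborel) < \<infinity>"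
proof -
  have mode: "(\<integral>\<^sup>+t\<in>{T0..}. ennreal \<bar>mode k t\<bar> \<partial>lborel) \<le> ennreal ((\<sigma> k)\<^sup>2)" for k
  proof -
    have "(\<integral>\<^sup>+t\<in>{T0..}. ennreal \<bar>mode k t\<bar> \<partial>lborel)
      = (\<integral>\<^sup>+t. ennreal ((\<sigma> k)\<^sup>2 * H k) * (ennreal ((1 - 2 * H k) * t powr (2 * H k - 2)) * indicator {T0..} t) \<partial>lborel)"
    proof (intro nn_integral_cong)
      fix t
      have "\<bar>mode k t\<bar> = ((\<sigma> k)\<^sup>2 * H k) * ((1 - 2 * H k) * t powr (2 * H k - 2))"
        using H[of k] H_pos[of k] by (simp add: mode_def abs_mult)
      then show "ennreal \<bar>mode k t\<bar> * indicator {T0..} t = ennreal ((\<sigma> k)\<^sup>2 * H k)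
          * (ennreal ((1 - 2 * H k) * t powr (2 * H k - 2)) * indicator {T0..} t)"
        using H[of k] H_pos[of k] by (simp add: ennreal_mult mult.assoc)
    qed
    also have "\<dots> = ennreal ((\<sigma> k)\<^sup>2 * H k)
        * (\<integral>\<^sup>+t\<in>{T0..}. ennreal ((1 - 2 * H k) * t powr (2 * H k - 2)) \<partial>lborel)"
      by (rule nn_integral_cmult) measurable
    also have "\<dots> \<le> ennreal ((\<sigma> k)\<^sup>2 * H k) * 1"
      by (intro mult_left_mono nn_integral_powr_atLeast_le H T0) simp
    also have "\<dots> \<le> ennreal ((\<sigma> k)\<^sup>2)"
      using H_less_1[of k] by (simp add: ennreal_leI mult_left_le)
    finally show ?thesis .
  qed
  have [measurable]: "mode k \<in> borel_measurable borel" for k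
    unfolding mode_def by measurable
  have "(\<integral>\<^sup>+t\<in>{T0..}. ennreal (abs_modes t) \<partial>lborel)
      = (\<integral>\<^sup>+t. (\<Sum>k. ennreal \<bar>mode k t\<bar> * indicator {T0..} t) \<partial>lborel)"
  proof (intro nn_integral_cong)
    fix t
    show "ennreal (abs_modes t) * indicator {T0..} t = (\<Sum>k. ennreal \<bar>mode k t\<bar> * indicator {T0..} t)"
    proof (cases "T0 \<le> t")
      case True
      then have "(\<Sum>k. ennreal \<bar>mode k t\<bar>) = ennreal (abs_modes t)"
        unfolding abs_modes_def using T0 by (intro suminf_ennreal2 summable_abs_mode) auto
      with True show ?thesis by simp
    qed simp
  qed
  also have "\<dots> = (\<Sum>k. \<integral>\<^sup>+t\<in>{T0..}. ennreal \<bar>mode k t\<bar> \<partial>lborel)"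
    by (rule nn_integral_suminf) measurable
  also have "\<dots> \<le> (\<Sum>k. ennreal ((\<sigma> k)\<^sup>2))"
    by (intro suminf_le mode) auto
  also have "\<dots> = ennreal (\<Sum>k. (\<sigma> k)\<^sup>2)"
    by (intro suminf_ennreal2 \<sigma>_summable) auto
  also have "\<dots> < \<infinity>" by simp
  finally show ?thesis .
qed

text \<open>The half-line is cut at a point beyond which the sum of moduli dominates; before it
  \<rho> is bounded. Every \<open>t0\<close> is treated, as refuting an existential over starting
  points requires.\<close>

lemma nn_integral_\<rho>_finite:
  assumes H: "\<And>k. H k \<le> 1 / 2" and t0: "0 < t0"
  shows "(\<integral>\<^sup>+t\<in>{t0..}. ennreal \<bar>\<rho> t\<bar> \<partial>lborel) < \<infinity>"
proof -
  have "\<forall>\<^sub>F t in at_top. rel_err t < 1"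
    using rel_err_tendsto by (rule order_tendstoD) simp
  \<comment> \<open>One multiple of the scaled sum of moduli pays for the limiting series, the other
    for the error with \<open>rel_err t < 1\<close>.\<close>
  then have "\<forall>\<^sub>F t in at_top. \<bar>\<rho> t\<bar> \<le> 2 * \<delta>\<^sup>2 * abs_modes t"
    using eventually_gt_at_top[of \<delta>]
  proof eventually_elim
    case (elim t)
    then have t: "0 < t" using \<delta>_pos by simp
    have "\<bar>\<rho> t - \<delta>\<^sup>2 * (\<Sum>k. mode k t)\<bar> \<le> rel_err t * (\<delta>\<^sup>2 * abs_modes t)"
      by (rule \<rho>_approx[OF elim(2)])
    also have "\<dots> \<le> 1 * (\<delta>\<^sup>2 * abs_modes t)"
      using elim(1) abs_modes_pos[OF t] by (intro mult_right_mono) auto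
    finally have 1: "\<bar>\<rho> t - \<delta>\<^sup>2 * (\<Sum>k. mode k t)\<bar> \<le> \<delta>\<^sup>2 * abs_modes t" by simp
    have "\<delta>\<^sup>2 * \<bar>\<Sum>k. mode k t\<bar> \<le> \<delta>\<^sup>2 * abs_modes t"
      using abs_suminf_mode_le[OF t] by (intro mult_left_mono) auto
    then have "\<bar>\<delta>\<^sup>2 * (\<Sum>k. mode k t)\<bar> \<le> \<delta>\<^sup>2 * abs_modes t" by (simp add: abs_mult)
    with 1 show ?case by linarith
  qed
  then obtain T1 where T1: "\<And>t. T1 \<le> t \<Longrightarrow> \<bar>\<rho> t\<bar> \<le> 2 * \<delta>\<^sup>2 * abs_modes t"
    by (auto simp: eventually_at_top_linorder)
  \<comment> \<open>\<open>T1\<close> secures the domination, and 1 the uniform bound on the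
    integrals of the modes. If \<open>t0\<close> exceeds \<open>T0\<close>, the bounded stretch is
    empty.\<close>
  define T0 where "T0 = max 1 T1"
  define K where "K = (\<Sum>k. (\<sigma> k)\<^sup>2) * (2 * (1 + (T0 + \<delta>)\<^sup>2))"
  have [measurable]: "mode k \<in> borel_measurable borel" for k
    unfolding mode_def by measurable
  have [measurable]: "abs_modes \<in> borel_measurable borel"
    unfolding abs_modes_def by measurable
  have "(\<integral>\<^sup>+t\<in>{t0..}. ennreal \<bar>\<rho> t\<bar> \<partial>lborel)
      \<le> (\<integral>\<^sup>+t. ennreal K * indicator {t0..T0} t
          + ennreal (2 * \<delta>\<^sup>2) * (ennreal (abs_modes t) * indicator {T0..} t) \<partial>lborel)"
  proof (intro nn_integral_mono)
    fix t
    show "ennreal \<bar>\<rho> t\<bar> * indicator {t0..} t \<le> ennreal K * indicator {t0..T0} t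
          + ennreal (2 * \<delta>\<^sup>2) * (ennreal (abs_modes t) * indicator {T0..} t)"
    proof (cases "T0 \<le> t")
      case True
      then have "0 < abs_modes t" "\<bar>\<rho> t\<bar> \<le> 2 * \<delta>\<^sup>2 * abs_modes t"
        using T1 by (auto simp: T0_def intro!: abs_modes_pos)
      then have "ennreal \<bar>\<rho> t\<bar> \<le> ennreal (2 * \<delta>\<^sup>2) * ennreal (abs_modes t)"
        by (simp add: ennreal_mult[symmetric] ennreal_leI)
      with True show ?thesis by (auto simp: indicator_def intro: add_increasing)
    next
      case False
      then have "ennreal \<bar>\<rho> t\<bar> \<le> ennreal K" if "t0 \<le> t"
        unfolding K_def using that t0 by (intro ennreal_leI abs_\<rho>_le) auto
      with False show ?thesis by (auto simp: indicator_def)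
    qed
  qed
  also have "\<dots> = (\<integral>\<^sup>+t. ennreal K * indicator {t0..T0} t \<partial>lborel)
      + ennreal (2 * \<delta>\<^sup>2) * (\<integral>\<^sup>+t\<in>{T0..}. ennreal (abs_modes t) \<partial>lborel)"
    by (subst nn_integral_add) (auto simp: nn_integral_cmult)
  also have "\<dots> < \<infinity>"
    using nn_integral_abs_modes_finite[OF H, of T0]
    by (auto simp: nn_integral_cmult_indicator T0_def ennreal_mult_less_top emeasure_lborel_Icc_eq)
  finally show ?thesis .
qed

end

section \<open>Transfer of the analytic results to the increment process\<close>

theorem theorem3p1:
  fixes P :: "'a measure"
    and T :: "real set"
    and \<sigma> H :: "nat \<Rightarrow> real"
    and B :: "nat \<Rightarrow> real \<Rightarrow> 'a \<Rightarrow> real"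
    and M :: "real \<Rightarrow> 'a \<Rightarrow> real"
    and \<delta> :: real
  assumes "prob_space P"
    and "T = UNIV \<or> T = {0..}"
    and "multi_mixed_fbm P T \<sigma> H B M"
    and "0 < \<delta>"
  shows "let \<Delta>M = increment \<delta> M;
             \<rho> = autocovariance P \<Delta>M;
             S = (\<lambda>t. \<delta>\<^sup>2 * (\<Sum>k. (\<sigma> k)\<^sup>2 * H k * (2 * H k - 1) * t powr (2 * H k - 2)))
         in stationary_process P T \<Delta>M \<and>
            (\<forall>s\<in>T. \<forall>t\<in>T. (\<integral>\<omega>. \<Delta>M (s + t) \<omega> * \<Delta>M s \<omega> \<partial>P) = \<rho> t) \<and>
            (\<forall>t>0. summable (\<lambda>k. (\<sigma> k)\<^sup>2 * H k * (2 * H k - 1) * t powr (2 * H k - 2))) \<and>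
            ((\<lambda>t. \<rho> t / S t) \<longlongrightarrow> 1) at_top \<and>
            S \<in> O(\<lambda>t. t powr (2 * (SUP k. H k) - 2)) \<and>
            \<rho> \<in> O(\<lambda>t. t powr (2 * (SUP k. H k) - 2)) \<and>
            (long_range_dependent P T \<Delta>M \<longleftrightarrow> (\<exists>k. H k > 1 / 2))"
proof -
  interpret prob_space P by fact
  define Y where "Y = increment \<delta> M"
  define \<rho> where "\<rho> = autocovariance P Y"
  have params: "0 < \<sigma> k" "summable (\<lambda>k. (\<sigma> k)\<^sup>2)" "0 < H k" "H k < 1" "inj H" for k
    using assms(3) unfolding multi_mixed_fbm_def by blast+
  have T: "0 \<in> T" "\<And>t. 0 \<le> t \<Longrightarrow> t \<in> T" "\<And>t. t \<in> T \<Longrightarrow> t + \<delta> \<in> T"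
      "\<And>s t. s \<in> T \<Longrightarrow> t \<in> T \<Longrightarrow> s + t \<in> T"
    using assms(2,4) by auto
  note inc = multi_mixed_fbm_increment[OF assms(3) _ T(3), folded Y_def]
  have cov: "(\<lambda>k. (\<sigma> k)\<^sup>2 * increment_cov \<delta> (H k) (t - s)) sums covariance P (Y t) (Y s)"
    if "t \<in> T" "s \<in> T" for t s
    using inc(3)[OF that(1) that(1) that(2) T(3)[OF that(2)]]
      inc(4)[OF that(1) that(1) that(2) T(3)[OF that(2)]] by simp
  have \<rho>: "(\<lambda>k. (\<sigma> k)\<^sup>2 * increment_cov \<delta> (H k) t) sums \<rho> t" if "t \<in> T" for t
    using cov[OF that T(1)] by (simp add: \<rho>_def autocovariance_def)
  interpret mmfbm_increment_cov \<sigma> H \<delta> \<rho>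
    by unfold_locales (use params assms(4) \<rho> T(2) in auto)
  have stationary: "stationary_process P T Y"
    unfolding stationary_process_def
  proof (intro conjI ballI allI impI)
    fix t assume "t \<in> T"
    then show "Y t \<in> borel_measurable P" "integrable P (\<lambda>\<omega>. (Y t \<omega>)\<^sup>2)"
      using inc(1) by (auto simp: square_integrable_def)
  next
    fix s t assume "s \<in> T" "t \<in> T"
    then show "(\<integral>\<omega>. Y s \<omega> \<partial>P) = (\<integral>\<omega>. Y t \<omega> \<partial>P)" using inc(2) by simp
  next
    fix s t h assume st: "s \<in> T" "t \<in> T" and h: "s + h \<in> T \<and> t + h \<in> T"
    \<comment> \<open>The shift \<open>h\<close> cancels in the lag, so both covariances are sums of
      the same series.\<close>
    have "(\<lambda>k. (\<sigma> k)\<^sup>2 * increment_cov \<delta> (H k) (s - t)) sums covariance P (Y (s + h)) (Y (t + h))"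
      using cov[of "s + h" "t + h"] h by simp
    then show "covariance P (Y (s + h)) (Y (t + h)) = covariance P (Y s) (Y t)"
      using cov[OF st] by (rule sums_unique2)
  qed
  have product: "(\<integral>\<omega>. Y (s + t) \<omega> * Y s \<omega> \<partial>P) = \<rho> t" if "s \<in> T" "t \<in> T" for s t
  proof -
    have "(\<lambda>k. (\<sigma> k)\<^sup>2 * increment_cov \<delta> (H k) t) sums (\<integral>\<omega>. Y (s + t) \<omega> * Y s \<omega> \<partial>P)"
      using inc(3)[OF T(4)[OF that] T(4)[OF that] that(1) T(3)[OF that(1)]] by simp
    then show ?thesis using \<rho>[OF that(2)] by (rule sums_unique2)
  qed
  \<comment> \<open>The supremum of reals is an upper bound because the family is bounded above by
    1.\<close>
  have H_le: "H k \<le> (SUP k. H k)" for k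
    by (rule cSUP_upper) (auto intro!: bdd_aboveI2[where M=1] less_imp_le params)
  have lrd: "long_range_dependent P T Y \<longleftrightarrow> (\<exists>k. H k > 1 / 2)"
  proof
    assume "long_range_dependent P T Y"
    then obtain t0 where "0 < t0" "(\<integral>\<^sup>+t\<in>{t0..}. ennreal \<bar>\<rho> t\<bar> \<partial>lborel) = \<infinity>"
      by (auto simp: long_range_dependent_def \<rho>_def)
    then show "\<exists>k. H k > 1 / 2"
      using nn_integral_\<rho>_finite[of t0] by (force simp: not_less)
  next
    assume "\<exists>k. H k > 1 / 2"
    then show "long_range_dependent P T Y"
      using stationary nn_integral_\<rho>_infinite by (auto simp: long_range_dependent_def \<rho>_def)
  qed
  show ?thesis
    unfolding Let_def Y_def[symmetric] \<rho>_def[symmetric]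
    using stationary product summable_mode \<rho>_asymp modes_bigo[OF H_le] \<rho>_bigo[OF H_le] lrd
    unfolding mode_def by blast
qed

end
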